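(* Let $G$ be a finite group with $\mathrm{Pr}(G,\mathrm{Aut}(G)) = \frac{p+q-1}{pq}$ for some primes $p$ and $q$. Then $pq$ divides $|G||\mathrm{Aut}(G)|$. If moreover $p$ and $q$ are the smallest primes dividing $|\mathrm{Aut}(G)|$ and $|G|$ respectively, then $$\frac{G}{L(G)}\cong \mathbb{Z}_q.$$ In particular, if $G$ and $\mathrm{Aut}(G)$ are of even order and $\mathrm{Pr}(G,\mathrm{Aut}(G)) = \frac{3}{4}$, then $\frac{G}{L(G)}\cong\mathbb{Z}_2$.
   Context: For a finite group $G$ with automorphism group $\mathrm{Aut}(G)$, let $L(G) := \{x\in G : \alpha(x)=x \text{ for all } \alpha\in\mathrm{Aut}(G)\}$ (a characteristic subgroup of $G$) and $$\mathrm{Pr}(G,\mathrm{Aut}(G)) := \frac{|\{(x,\alpha)\in G\times \mathrm{Aut}(G) : \alpha(x)=x\}|}{|G||\mathrm{Aut}(G)|}.$$ $\mathbb{Z}_n$ denotes the cyclic group of order $n$. *)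

theory Defs
  imports
    Complex_Main
    "HOL-Algebra.Bij"
    "HOL-Algebra.Elementary_Groups"
    "HOL-Computational_Algebra.Primes"
begin

text \<open>
  The automorphism group of \<open>G\<close> is the library's \<open>AutoGroup G\<close>. Its carrier \<open>auto G\<close> contains only
  functions that are extensional on \<open>carrier G\<close>, so distinct elements are distinct automorphisms
  and its order is the number of automorphisms of \<open>G\<close>.
\<close>

definition aut_fixed :: "('a, 'b) monoid_scheme \<Rightarrow> 'a set" where
  "aut_fixed G = {x \<in> carrier G. \<forall>\<alpha> \<in> carrier (AutoGroup G). \<alpha> x = x}"

definition aut_comm_prob :: "('a, 'b) monoid_scheme \<Rightarrow> real" where
  "aut_comm_prob G =
     real (card {(x, \<alpha>) \<in> carrier G \<times> carrier (AutoGroup G). \<alpha> x = x}) /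
     (real (order G) * real (order (AutoGroup G)))"

definition smallest_prime_divisor :: "nat \<Rightarrow> nat \<Rightarrow> bool" where
  "smallest_prime_divisor p n \<longleftrightarrow>
     Factorial_Ring.prime p \<and> p dvd n \<and>
     (\<forall>r. Factorial_Ring.prime r \<and> r dvd n \<longrightarrow> p \<le> r)"

lemma carrier_AutoGroup: "carrier (AutoGroup G) = auto G"
  by (simp add: AutoGroup_def)

lemma (in group) conjugation_in_auto:
  assumes g: "g \<in> carrier G"
  shows "(\<lambda>x\<in>carrier G. g \<otimes> x \<otimes> inv g) \<in> auto G"
proof -
  have cancel: "inv g \<otimes> (g \<otimes> x) = x" "g \<otimes> (inv g \<otimes> x) = x" if "x \<in> carrier G" for x
    using g that by (simp_all add: m_assoc[symmetric])
  let ?c = "\<lambda>x\<in>carrier G. g \<otimes> x \<otimes> inv g"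
  have "bij_betw ?c (carrier G) (carrier G)"
    by (rule bij_betw_byWitness[where f' = "\<lambda>x. inv g \<otimes> x \<otimes> g"])
       (use g in \<open>auto simp: m_assoc cancel\<close>)
  moreover have "?c \<in> hom G G"
    using g by (auto simp: hom_def m_assoc cancel)
  ultimately show ?thesis
    by (simp add: auto_def Bij_def)
qed

text \<open>The quotient \<open>G Mod aut_fixed G\<close> is therefore a genuine quotient group.\<close>

lemma (in group) aut_fixed_normal: "aut_fixed G \<lhd> G"
proof -
  have auto_hom: "\<alpha> \<in> hom G G" if "\<alpha> \<in> auto G" for \<alpha>
    using that by (simp add: auto_def)
  have sub: "subgroup (aut_fixed G) G"
  proof
    show "aut_fixed G \<subseteq> carrier G"
      by (auto simp: aut_fixed_def)
    show "x \<otimes> y \<in> aut_fixed G" if "x \<in> aut_fixed G" "y \<in> aut_fixed G" for x y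
      using that by (auto simp: aut_fixed_def carrier_AutoGroup hom_mult[OF auto_hom] dest!: bspec)
    show "\<one> \<in> aut_fixed G"
      using auto_hom hom_one[OF _ is_group is_group]
      by (auto simp: aut_fixed_def carrier_AutoGroup)
    show "inv x \<in> aut_fixed G" if "x \<in> aut_fixed G" for x
    proof -
      have "\<alpha> (inv x) = inv x" if "\<alpha> \<in> auto G" for \<alpha>
      proof -
        interpret group_hom G G \<alpha>
          using auto_hom[OF that] by unfold_locales
        show ?thesis
          using \<open>x \<in> aut_fixed G\<close> that by (auto simp: aut_fixed_def carrier_AutoGroup dest!: bspec)
      qed
      with that show ?thesis
        by (simp add: aut_fixed_def carrier_AutoGroup)
    qed
  qed
  have "g \<otimes> x \<otimes> inv g \<in> aut_fixed G" if "g \<in> carrier G" "x \<in> aut_fixed G" for g x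
  proof -
    have "x \<in> carrier G" "\<forall>\<alpha>\<in>auto G. \<alpha> x = x"
      using that(2) by (auto simp: aut_fixed_def carrier_AutoGroup)
    with conjugation_in_auto[OF that(1)] have "g \<otimes> x \<otimes> inv g = x"
      by fastforce
    with that(2) show ?thesis by simp
  qed
  with sub show ?thesis
    by (simp add: normal_inv_iff)
qed

end

theory Submission
  imports
    Defs
    "HOL-Algebra.Group_Action"
    "HOL-Algebra.Sylow"
    "HOL-Algebra.Multiplicative_Group"
    "HOL-Number_Theory.Cong"
begin

text \<open>
  Let \<open>A\<close> be the automorphism group of \<open>G\<close>, \<open>L\<close> its group of fixed points, and \<open>P\<close> the
  probability, which counts pairs \<open>(x, \<alpha>)\<close> with \<open>\<alpha> x = x\<close>. The number \<open>(p + q - 1) / (p q)\<close> is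
  \<open>1 / q + (1 - 1 / q) / p\<close> and also \<open>1 / p + (1 - 1 / p) / q\<close>, and each form matches an upper
  bound for \<open>P\<close>.

  Counting the pairs by elements, where an element outside \<open>L\<close> is fixed by a proportion of at
  most \<open>1 / p\<close> of the automorphisms if \<open>p\<close> is the smallest prime divisor of \<open>|A|\<close>, gives
  \<open>P \<le> 1 / p + (1 - 1 / p) / [G : L]\<close> (\<open>aut_comm_prob_le_index\<close>). Hence \<open>[G : L] \<le> q\<close>. As
  \<open>P < 1\<close>, the index is not 1, so it is at least the smallest prime divisor \<open>q\<close> of \<open>|G|\<close>, and
  \<open>G / L\<close> has prime order \<open>q\<close>.

  For the divisibility, Burnside's lemma writes \<open>P\<close> as the number of orbits of \<open>A\<close> divided by
  \<open>|G|\<close>. The case \<open>p = q\<close> is immediate, and by symmetry let \<open>p < q\<close>. Then \<open>q\<close> does not divide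
  \<open>p + q - 1\<close>, so it divides \<open>|G|\<close>, and so does \<open>p\<close> unless the fraction cancels, that is, unless
  \<open>p\<close> divides \<open>q - 1\<close>. In this remaining case the factor \<open>p\<close> comes from \<open>|A|\<close>, as follows.

  Counting the pairs by automorphisms, one that moves a \<open>q\<close>-element \<open>x\<close> fixes at most \<open>|G| / q\<close>
  elements, so \<open>P \<le> 1 / q + (1 - 1 / q) / |A x|\<close> for the orbit \<open>A x\<close> of every \<open>q\<close>-element
  (\<open>aut_comm_prob_le_orbit\<close>). Hence \<open>|A x| \<le> p < q\<close>. Since conjugation by a \<open>q\<close>-element that
  does not commute with \<open>x\<close> would produce \<open>q\<close> points in the orbit of \<open>x\<close>, the \<open>q\<close>-elements
  commute with each other, and they form an abelian normal Sylow subgroup \<open>N\<close>. The transfer into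
  \<open>N\<close> shows that the power maps with exponent prime to \<open>q\<close> on \<open>N\<close> extend to automorphisms of
  \<open>G\<close> (\<open>power_automorphism\<close>). So some \<open>q\<close>-element \<open>x\<close> has an orbit of at least \<open>q - 1 \<ge> p\<close>
  points. This orbit then has exactly \<open>p\<close> points, and its size divides \<open>|A|\<close>.
\<close>

section \<open>Elements of prime power order\<close>

lemma coprime_prime_power:
  fixes q d a :: nat
  assumes "Factorial_Ring.prime q" "0 < d" "d < q"
  shows "coprime d (q ^ a)"
proof -
  have "\<not> q dvd d" using assms by (simp add: nat_dvd_not_less)
  then have "coprime q d" using assms(1) prime_imp_coprime by blast
  then show ?thesis by (simp add: coprime_commute)
qed

lemma (in group) pow_cong_exponent:
  fixes i j e :: nat
  assumes "x \<in> carrier G" "x [^] e = \<one>" "[i = j] (mod e)"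
  shows "x [^] i = x [^] j"
proof -
  have "ord x dvd e" using assms pow_eq_id by blast
  then have "[int i = int j] (mod int (ord x))"
    using assms(3) cong_dvd_modulus cong_int_iff int_dvd_int_iff by blast
  then have "x [^] (int i) = x [^] (int j)"
    using int_pow_eq[OF assms(1)] by (simp add: cong_iff_dvd_diff dvd_diff_commute)
  then show ?thesis by (simp add: int_pow_int)
qed

lemma (in group) root_in_subgroup:
  fixes d e :: nat
  assumes x: "x \<in> carrier G" "x [^] e = \<one>" and C: "subgroup C G"
    and d: "coprime d e" "x [^] d \<in> C"
  shows "x \<in> C"
proof -
  obtain u where u: "[d * u = 1] (mod e)"
    using cong_solve_coprime_nat d(1) by auto
  have "x = x [^] (d * u)"
    using pow_cong_exponent[OF x u] x by simp
  also have "\<dots> = (x [^] d) [^] u"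
    using x by (simp add: nat_pow_pow)
  also have "\<dots> \<in> C"
    using monoid.nat_pow_closed[OF group.is_monoid[OF subgroup_imp_group[OF C]], of "x [^] d" u] d(2)
    by (simp flip: nat_pow_consistent)
  finally show ?thesis .
qed

text \<open>
  Outside a subgroup \<open>C\<close>, the powers \<open>1, x, \<dots>, x\<^sup>q\<^sup>-\<^sup>1\<close> of a \<open>q\<close>-element lie in different
  cosets of \<open>C\<close>: a relation between two of them would put a power \<open>x\<^sup>d\<close> with \<open>d\<close> prime to \<open>q\<close>,
  and hence \<open>x\<close> itself, in \<open>C\<close>.
\<close>

lemma (in group) powers_in_distinct_cosets:
  fixes q a i j :: nat
  assumes q: "Factorial_Ring.prime q" and x: "x \<in> carrier G" "x [^] (q ^ a) = \<one>"
    and C: "subgroup C G" "x \<notin> C"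
    and ij: "i < q" "j < q" and eq: "inv (x [^] i) \<otimes> x [^] j \<in> C"
  shows "i = j"
proof -
  have step: "i' = j'"
    if le: "i' \<le> j'" and lt: "j' < q" and in_C: "inv (x [^] i') \<otimes> x [^] j' \<in> C" for i' j'
  proof (rule ccontr)
    assume "i' \<noteq> j'"
    define d where "d = j' - i'"
    have d: "0 < d" "d < q" using le lt \<open>i' \<noteq> j'\<close> by (auto simp: d_def)
    have "x [^] j' = x [^] i' \<otimes> x [^] d"
      using x le by (simp add: d_def nat_pow_mult)
    then have "inv (x [^] i') \<otimes> x [^] j' = x [^] d"
      using x by (simp add: m_assoc[symmetric])
    with in_C have "x [^] d \<in> C" by simp
    moreover have "coprime d (q ^ a)"
      using q d by (rule coprime_prime_power)
    ultimately show False
      using root_in_subgroup[OF x C(1)] C(2) by blast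
  qed
  show ?thesis
  proof (cases "i \<le> j")
    case True
    then show ?thesis using step ij eq by blast
  next
    case False
    have "inv (inv (x [^] i) \<otimes> x [^] j) \<in> C"
      by (rule subgroup.m_inv_closed[OF C(1) eq])
    then have "inv (x [^] j) \<otimes> x [^] i \<in> C"
      using x by (simp add: inv_mult_group)
    then show ?thesis using step[of j i] ij False by simp
  qed
qed

lemma (in group) card_subgroup_avoiding_prime_power_element:
  fixes q a :: nat
  assumes fin: "finite (carrier G)" and q: "Factorial_Ring.prime q"
    and x: "x \<in> carrier G" "x [^] (q ^ a) = \<one>" and C: "subgroup C G" "x \<notin> C"
  shows "q * card C \<le> order G"
proof -
  have CG: "C \<subseteq> carrier G" using C(1) subgroup.subset by blast
  have "inj_on (\<lambda>(i, c). x [^] i \<otimes> c) ({..<q} \<times> C)"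
  proof (rule inj_onI, clarsimp)
    fix i c j d
    assume ij: "i < q" "j < q" and cd: "c \<in> C" "d \<in> C"
      and eq: "x [^] i \<otimes> c = x [^] j \<otimes> d"
    have cd': "c \<in> carrier G" "d \<in> carrier G" using cd CG by auto
    have "inv (x [^] i) \<otimes> x [^] j = c \<otimes> inv d"
    proof -
      have "x [^] j = x [^] i \<otimes> c \<otimes> inv d"
        using eq x cd' by (metis inv_solve_right m_closed nat_pow_closed)
      then show ?thesis using x cd' by (simp add: m_assoc[symmetric])
    qed
    also have "\<dots> \<in> C"
      using cd C(1) by (simp add: subgroup.m_closed subgroup.m_inv_closed)
    finally have "i = j"
      using powers_in_distinct_cosets[OF q x C] ij by auto
    with eq show "i = j \<and> c = d" using x cd' by auto
  qed
  moreover have "(\<lambda>(i, c). x [^] i \<otimes> c) ` ({..<q} \<times> C) \<subseteq> carrier G"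
    using x CG by auto
  ultimately have "card ({..<q} \<times> C) \<le> card (carrier G)"
    using fin card_inj_on_le by blast
  then show ?thesis by (simp add: order_def card_cartesian_product)
qed

section \<open>The action of the automorphism group\<close>

abbreviation aut_orbit :: "('a, 'b) monoid_scheme \<Rightarrow> 'a \<Rightarrow> 'a set" where
  "aut_orbit G x \<equiv> orbit (AutoGroup G) (\<lambda>\<alpha>. \<alpha>) x"

abbreviation aut_stabilizer :: "('a, 'b) monoid_scheme \<Rightarrow> 'a \<Rightarrow> ('a \<Rightarrow> 'a) set" where
  "aut_stabilizer G x \<equiv> stabilizer (AutoGroup G) (\<lambda>\<alpha>. \<alpha>) x"

lemma (in group) auto_action: "group_action (AutoGroup G) (carrier G) (\<lambda>\<alpha>. \<alpha>)"
proof -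
  have "(\<lambda>\<alpha>. \<alpha>) \<in> hom (AutoGroup G) (BijGroup (carrier G))"
    by (auto simp: hom_def AutoGroup_def BijGroup_def auto_def)
  then show ?thesis
    using AutoGroup group_BijGroup
    by (auto simp: group_action_def group_hom_def group_hom_axioms_def)
qed

lemma (in group) finite_auto:
  assumes "finite (carrier G)" shows "finite (auto G)"
proof -
  have "auto G \<subseteq> carrier G \<rightarrow>\<^sub>E carrier G"
    by (auto simp: auto_def hom_def Bij_def PiE_def)
  then show ?thesis
    by (rule finite_subset) (simp add: finite_PiE assms)
qed

lemma (in group) order_AutoGroup_pos:
  assumes "finite (carrier G)" shows "order (AutoGroup G) > 0"
  using finite_auto[OF assms] id_in_auto
  by (auto simp: order_def carrier_AutoGroup card_gt_0_iff)

lemma (in group) aut_orbit_eq_image: "aut_orbit G x = (\<lambda>\<alpha>. \<alpha> x) ` auto G"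
  by (auto simp: orbit_def carrier_AutoGroup)

lemma (in group) finite_aut_orbit:
  "finite (carrier G) \<Longrightarrow> finite (aut_orbit G x)"
  by (simp add: aut_orbit_eq_image finite_auto)

lemma (in group) card_aut_orbit_pos:
  "finite (carrier G) \<Longrightarrow> card (aut_orbit G x) > 0"
  using finite_aut_orbit id_in_auto by (auto simp: card_gt_0_iff aut_orbit_eq_image)

lemma (in group) aut_orbit_stabilizer:
  "x \<in> carrier G \<Longrightarrow> card (aut_orbit G x) * card (aut_stabilizer G x) = order (AutoGroup G)"
  by (rule group_action.orbit_stabilizer_theorem[OF auto_action])

lemma (in group) fixed_points_subgroup:
  assumes "\<alpha> \<in> auto G"
  shows "subgroup {x \<in> carrier G. \<alpha> x = x} G"
proof -
  interpret \<alpha>: group_hom G G \<alpha>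
    using assms by (unfold_locales) (simp add: auto_def)
  show ?thesis
    by (rule subgroupI) auto
qed

text \<open>The numerator of the probability, counted along either coordinate of the pairs.\<close>

lemma (in group) fixing_pairs_by_automorphism:
  assumes fin: "finite (carrier G)"
  shows "aut_comm_prob G * (real (order G) * real (order (AutoGroup G)))
         = (\<Sum>\<alpha>\<in>auto G. real (card {x \<in> carrier G. \<alpha> x = x}))"
proof -
  have "{(x, \<alpha>) \<in> carrier G \<times> auto G. \<alpha> x = x}
        = (\<lambda>(\<alpha>, x). (x, \<alpha>)) ` (SIGMA \<alpha>:auto G. {x \<in> carrier G. \<alpha> x = x})"
    by auto
  moreover have "inj_on (\<lambda>(\<alpha>, x). (x, \<alpha>)) (SIGMA \<alpha>:auto G. {x \<in> carrier G. \<alpha> x = x})"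
    by (auto simp: inj_on_def)
  ultimately have "card {(x, \<alpha>) \<in> carrier G \<times> auto G. \<alpha> x = x}
        = (\<Sum>\<alpha>\<in>auto G. card {x \<in> carrier G. \<alpha> x = x})"
    using fin finite_auto by (simp add: card_image)
  moreover have "real (order G) * real (order (AutoGroup G)) \<noteq> 0"
    using fin order_AutoGroup_pos order_gt_0_iff_finite by simp
  ultimately show ?thesis
    by (simp add: aut_comm_prob_def carrier_AutoGroup)
qed

lemma (in group) fixing_pairs_by_element:
  assumes fin: "finite (carrier G)"
  shows "aut_comm_prob G * (real (order G) * real (order (AutoGroup G)))
         = (\<Sum>x\<in>carrier G. real (card (aut_stabilizer G x)))"
proof -
  have "{(x, \<alpha>) \<in> carrier G \<times> auto G. \<alpha> x = x} = (SIGMA x:carrier G. aut_stabilizer G x)"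
    by (auto simp: stabilizer_def carrier_AutoGroup)
  moreover have "finite (aut_stabilizer G x)" for x
    using fin finite_auto by (simp add: stabilizer_def carrier_AutoGroup)
  ultimately have "card {(x, \<alpha>) \<in> carrier G \<times> auto G. \<alpha> x = x}
        = (\<Sum>x\<in>carrier G. card (aut_stabilizer G x))"
    using fin by simp
  moreover have "real (order G) * real (order (AutoGroup G)) \<noteq> 0"
    using fin order_AutoGroup_pos order_gt_0_iff_finite by simp
  ultimately show ?thesis
    by (simp add: aut_comm_prob_def carrier_AutoGroup)
qed

lemma (in group) aut_comm_prob_orbits:
  assumes fin: "finite (carrier G)"
  shows "aut_comm_prob G = real (card (orbits (AutoGroup G) (carrier G) (\<lambda>\<alpha>. \<alpha>))) / real (order G)"
proof -
  interpret act: group_action "AutoGroup G" "carrier G" "\<lambda>\<alpha>. \<alpha>" by (rule auto_action)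
  have pos: "real (order G) > 0" "real (order (AutoGroup G)) > 0"
    using fin order_AutoGroup_pos order_gt_0_iff_finite by auto
  have "card (orbits (AutoGroup G) (carrier G) (\<lambda>\<alpha>. \<alpha>)) * order (AutoGroup G)
        = (\<Sum>\<alpha>\<in>auto G. card {x \<in> carrier G. \<alpha> x = x})"
    using act.burnside fin finite_auto by (simp add: carrier_AutoGroup invariants_def)
  then have "real (card (orbits (AutoGroup G) (carrier G) (\<lambda>\<alpha>. \<alpha>))) * real (order (AutoGroup G))
        = aut_comm_prob G * (real (order G) * real (order (AutoGroup G)))"
    using fixing_pairs_by_automorphism[OF fin] by (simp flip: of_nat_mult of_nat_sum)
  then show ?thesis using pos by (simp add: field_simps)
qed

section \<open>Two bounds for the probability\<close>

text \<open>
  An automorphism moving \<open>x\<close> has a subgroup of fixed points of index at least \<open>q\<close>, and the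
  automorphisms that fix \<open>x\<close> make up the fraction \<open>1 / card (aut_orbit G x)\<close> of all of them.
\<close>

lemma (in group) aut_comm_prob_le_orbit:
  fixes q a :: nat
  assumes fin: "finite (carrier G)" and q: "Factorial_Ring.prime q"
    and x: "x \<in> carrier G" "x [^] (q ^ a) = \<one>"
  shows "aut_comm_prob G \<le> 1 / q + (1 - 1 / q) / card (aut_orbit G x)"
proof -
  let ?S = "aut_stabilizer G x" and ?o = "real (card (aut_orbit G x))"
  let ?g = "real (order G)" and ?A = "real (order (AutoGroup G))"
  have q0: "real q > 0" using q prime_gt_0_nat by simp
  have pos: "?g > 0" "?A > 0" "?o > 0"
    using fin order_AutoGroup_pos order_gt_0_iff_finite card_aut_orbit_pos by auto
  have S: "?S \<subseteq> auto G" by (auto simp: stabilizer_def carrier_AutoGroup)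
  have moved: "real (card {y \<in> carrier G. \<alpha> y = y}) \<le> ?g / q" if "\<alpha> \<in> auto G - ?S" for \<alpha>
  proof -
    have "x \<notin> {y \<in> carrier G. \<alpha> y = y}"
      using that by (auto simp: stabilizer_def carrier_AutoGroup)
    then have "q * card {y \<in> carrier G. \<alpha> y = y} \<le> order G"
      using card_subgroup_avoiding_prime_power_element[OF fin q x fixed_points_subgroup] that
      by blast
    then have "real q * real (card {y \<in> carrier G. \<alpha> y = y}) \<le> ?g"
      by (metis of_nat_le_iff of_nat_mult)
    then show ?thesis using q0 by (simp add: field_simps)
  qed
  have all: "real (card {y \<in> carrier G. \<alpha> y = y}) \<le> ?g" for \<alpha>
    using fin by (simp add: order_def card_mono)
  have s: "?o * real (card ?S) = ?A"
    using aut_orbit_stabilizer[OF x(1)] by (simp flip: of_nat_mult)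
  have diff: "real (card (auto G - ?S)) = ?A - card ?S"
    using S finite_auto[OF fin] by (simp add: card_Diff_subset finite_subset card_mono order_def
        carrier_AutoGroup of_nat_diff)
  have "aut_comm_prob G * (?g * ?A) = (\<Sum>\<alpha>\<in>?S. real (card {x \<in> carrier G. \<alpha> x = x}))
      + (\<Sum>\<alpha>\<in>auto G - ?S. real (card {x \<in> carrier G. \<alpha> x = x}))"
    using fixing_pairs_by_automorphism[OF fin] sum.subset_diff[OF S finite_auto[OF fin]]
    by (simp add: add.commute)
  also have "\<dots> \<le> real (card ?S) * ?g + real (card (auto G - ?S)) * (?g / q)"
    by (intro add_mono sum_bounded_above all moved)
  also have "\<dots> = (1 / q + (1 - 1 / q) / ?o) * (?g * ?A)"
    unfolding diff s[symmetric] using q0 pos(3) by (simp add: field_simps)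
  finally show ?thesis using pos by simp
qed

text \<open>
  The same estimate with the roles of elements and automorphisms exchanged: an element outside
  \<open>aut_fixed G\<close> has an orbit whose size divides \<open>order (AutoGroup G)\<close> and exceeds 1, and is therefore at least \<open>p\<close>.
\<close>

lemma (in group) aut_comm_prob_le_index:
  fixes p :: nat
  assumes fin: "finite (carrier G)" and p: "smallest_prime_divisor p (order (AutoGroup G))"
  shows "aut_comm_prob G \<le> 1 / p + (1 - 1 / p) / order (G Mod aut_fixed G)"
proof -
  let ?L = "aut_fixed G" and ?i = "real (order (G Mod aut_fixed G))"
  let ?g = "real (order G)" and ?A = "real (order (AutoGroup G))"
  have p0: "real p > 0" using p prime_gt_0_nat by (simp add: smallest_prime_divisor_def)
  have pos: "?g > 0" "?A > 0"
    using fin order_AutoGroup_pos order_gt_0_iff_finite by auto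
  have L: "?L \<subseteq> carrier G" by (auto simp: aut_fixed_def)
  have moved: "real (card (aut_stabilizer G x)) \<le> ?A / p" if x: "x \<in> carrier G - ?L" for x
  proof -
    obtain \<alpha> where \<alpha>: "\<alpha> \<in> auto G" "\<alpha> x \<noteq> x"
      using x unfolding aut_fixed_def carrier_AutoGroup by blast
    have "card {\<alpha> x, x} \<le> card (aut_orbit G x)"
      using \<alpha> x id_in_auto finite_aut_orbit[OF fin]
      by (intro card_mono) (auto simp: aut_orbit_eq_image intro!: image_eqI[of x _ "\<lambda>x\<in>carrier G. x"])
    then have "card (aut_orbit G x) \<noteq> 1" using \<alpha> by simp
    then obtain r where r: "Factorial_Ring.prime r" "r dvd card (aut_orbit G x)"
      using prime_factor_nat by blast
    have os: "card (aut_orbit G x) * card (aut_stabilizer G x) = order (AutoGroup G)"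
      using aut_orbit_stabilizer x by simp
    then have "p \<le> r"
      using p r by (metis dvd_mult2 smallest_prime_divisor_def)
    also have "r \<le> card (aut_orbit G x)"
      using r card_aut_orbit_pos[OF fin] by (simp add: dvd_imp_le)
    finally have "p * card (aut_stabilizer G x) \<le> order (AutoGroup G)"
      using os by (metis mult_le_mono1)
    then have "real p * real (card (aut_stabilizer G x)) \<le> ?A"
      by (metis of_nat_le_iff of_nat_mult)
    then show ?thesis using p0 by (simp add: field_simps)
  qed
  have all: "real (card (aut_stabilizer G x)) \<le> ?A" for x
    using finite_auto[OF fin]
    by (auto simp: order_def carrier_AutoGroup stabilizer_def intro!: card_mono)
  have index: "?i * real (card ?L) = ?g"
    using lagrange[OF normal_imp_subgroup[OF aut_fixed_normal]]
    by (simp add: order_def FactGroup_def flip: of_nat_mult)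
  then have i0: "?i > 0" using pos(1) by (metis mult_zero_left less_irrefl of_nat_0_less_iff gr0I of_nat_0)
  have diff: "real (card (carrier G - ?L)) = ?g - card ?L"
    using L fin by (simp add: card_Diff_subset finite_subset card_mono order_def of_nat_diff)
  have "aut_comm_prob G * (?g * ?A) = (\<Sum>x\<in>?L. real (card (aut_stabilizer G x)))
      + (\<Sum>x\<in>carrier G - ?L. real (card (aut_stabilizer G x)))"
    using fixing_pairs_by_element[OF fin] sum.subset_diff[OF L fin]
    by (simp add: add.commute)
  also have "\<dots> \<le> real (card ?L) * ?A + real (card (carrier G - ?L)) * (?A / p)"
    by (intro add_mono sum_bounded_above all moved)
  also have "\<dots> = (1 / p + (1 - 1 / p) / ?i) * (?g * ?A)"
    unfolding diff index[symmetric] using p0 i0 by (simp add: field_simps)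
  finally show ?thesis using pos by simp
qed

section \<open>Power automorphisms\<close>

lemma (in comm_monoid) hom_finprod:
  assumes h: "h \<in> hom G G" "h \<one> = \<one>" and f: "f \<in> A \<rightarrow> carrier G"
  shows "h (finprod G f A) = finprod G (\<lambda>x. h (f x)) A"
  using f
proof (induction A rule: infinite_finite_induct)
  case (insert a A)
  have "(\<lambda>x. h (f x)) \<in> A \<rightarrow> carrier G" "h (f a) \<in> carrier G"
    using h(1) insert.prems by (auto simp: hom_def Pi_iff)
  then show ?case
    using insert h by (simp add: hom_mult Pi_iff)
qed (use h in simp_all)

text \<open>
  The transfer into an abelian normal subgroup \<open>N\<close>, in the form of a crossed homomorphism. For
  representatives \<open>s\<close> of the cosets, \<open>g \<otimes> s U\<close> differs from the representative of the coset \<open>gU\<close>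
  by a factor \<open>m g U\<close> in \<open>N\<close>, and \<open>F g\<close> is the product of these factors over all \<open>U\<close>. The
  factors satisfy \<open>m (g h) U = g (m h U) g\<^sup>-\<^sup>1 (m g (hU))\<close>, and \<open>hU\<close> runs over all cosets with \<open>U\<close>.
  For \<open>g\<close> in \<open>N\<close> the coset does not change, so each factor is \<open>g\<close>.
\<close>

lemma (in group) transfer_crossed_hom:
  assumes N: "N \<lhd> G" and comm: "\<And>x y. x \<in> N \<Longrightarrow> y \<in> N \<Longrightarrow> x \<otimes> y = y \<otimes> x"
  obtains F where "\<And>g. g \<in> carrier G \<Longrightarrow> F g \<in> N"
    and "\<And>g h. g \<in> carrier G \<Longrightarrow> h \<in> carrier G \<Longrightarrow> F (g \<otimes> h) = g \<otimes> F h \<otimes> inv g \<otimes> F g"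
    and "\<And>g. g \<in> N \<Longrightarrow> F g = g [^] order (G Mod N)"
proof -
  interpret N: normal N G by (rule N)
  interpret Q: group "G Mod N" by (rule N.factorgroup_is_group)
  interpret \<pi>: group_hom G "G Mod N" "\<lambda>a. N #> a"
    using N.r_coset_hom_Mod by unfold_locales
  let ?M = "G\<lparr>carrier := N\<rparr>"
  interpret M: comm_group ?M
    using subgroup_imp_group[OF N.subgroup_axioms] comm
    by (intro group.group_comm_groupI) auto
  let ?Q = "carrier (G Mod N)"
  define s where "s = (\<lambda>U. SOME x. x \<in> carrier G \<and> N #> x = U)"
  have s: "s U \<in> carrier G" "N #> s U = U" if "U \<in> ?Q" for U
  proof -
    have "\<exists>x. x \<in> carrier G \<and> N #> x = U"
      using that by (auto simp: carrier_FactGroup)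
    from someI_ex[OF this] show "s U \<in> carrier G" "N #> s U = U"
      by (auto simp: s_def)
  qed
  define act where "act = (\<lambda>g U. (N #> g) \<otimes>\<^bsub>G Mod N\<^esub> U)"
  have act_closed: "act g U \<in> ?Q" if "g \<in> carrier G" "U \<in> ?Q" for g U
    unfolding act_def using that by (intro Q.m_closed \<pi>.hom_closed)
  define m where "m = (\<lambda>g U. g \<otimes> s U \<otimes> inv (s (act g U)))"
  have m_N: "m g U \<in> N" if "g \<in> carrier G" "U \<in> ?Q" for g U
  proof -
    have c: "s U \<in> carrier G" "s (act g U) \<in> carrier G"
      using that act_closed s by auto
    have "N #> m g U = (N #> g) \<otimes>\<^bsub>G Mod N\<^esub> (N #> s U) \<otimes>\<^bsub>G Mod N\<^esub> inv\<^bsub>G Mod N\<^esub> (N #> s (act g U))"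
      unfolding m_def using that c by (simp only: \<pi>.hom_mult \<pi>.hom_inv m_closed inv_closed)
    also have "\<dots> = act g U \<otimes>\<^bsub>G Mod N\<^esub> inv\<^bsub>G Mod N\<^esub> act g U"
      using that act_closed s by (simp only: act_def)
    also have "\<dots> = N" using Q.r_inv[OF act_closed[OF that]] by simp
    finally have "N #> m g U = N" .
    moreover have "m g U \<in> carrier G" unfolding m_def using that c by simp
    ultimately show ?thesis
      using N.subgroup_axioms by (rule coset_join1)
  qed
  define F where "F = (\<lambda>g. finprod ?M (m g) ?Q)"
  have F_N: "F g \<in> N" if "g \<in> carrier G" for g
    using M.finprod_closed[of "m g" ?Q] m_N that by (auto simp: F_def)
  have F_mult: "F (g \<otimes> h) = g \<otimes> F h \<otimes> inv g \<otimes> F g"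
    if g: "g \<in> carrier G" and h: "h \<in> carrier G" for g h
  proof -
    let ?c = "\<lambda>x. g \<otimes> x \<otimes> inv g"
    have cancel: "inv a \<otimes> (a \<otimes> b) = b" if "a \<in> carrier G" "b \<in> carrier G" for a b
      using that by (simp add: m_assoc[symmetric])
    have c_N: "?c x \<in> N" if "x \<in> N" for x
      using that g N.inv_op_closed2 by blast
    have c_hom: "?c \<in> hom ?M ?M"
    proof -
      have "?c (x \<otimes> y) = ?c x \<otimes> ?c y" if "x \<in> carrier G" "y \<in> carrier G" for x y
        using that g by (simp add: m_assoc cancel)
      then show ?thesis using c_N N.subset by (auto simp: hom_def)
    qed
    have cocycle: "m (g \<otimes> h) U = ?c (m h U) \<otimes> m g (act h U)" if U: "U \<in> ?Q" for U
    proof -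
      have aa: "act (g \<otimes> h) U = act g (act h U)"
        unfolding act_def using g h U by (simp only: \<pi>.hom_mult \<pi>.hom_closed Q.m_assoc)
      have c: "s U \<in> carrier G" "s (act h U) \<in> carrier G" "s (act g (act h U)) \<in> carrier G"
        using U g h act_closed s by auto
      show ?thesis
        unfolding m_def aa using c g h by (simp add: m_assoc cancel)
    qed
    have bij: "inj_on (act h) ?Q" "act h ` ?Q = ?Q"
    proof -
      show "inj_on (act h) ?Q"
        unfolding act_def using h by (intro inj_onI) (metis Q.Units_eq Q.Units_l_cancel \<pi>.hom_closed)
      have "U \<in> act h ` ?Q" if "U \<in> ?Q" for U
      proof
        have hN: "N #> h \<in> ?Q" using h by (rule \<pi>.hom_closed)
        show "inv\<^bsub>G Mod N\<^esub> (N #> h) \<otimes>\<^bsub>G Mod N\<^esub> U \<in> ?Q"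
          using that hN by (intro Q.m_closed Q.inv_closed)
        show "U = act h (inv\<^bsub>G Mod N\<^esub> (N #> h) \<otimes>\<^bsub>G Mod N\<^esub> U)"
          unfolding act_def using that hN by (simp only: Q.m_assoc[symmetric] Q.inv_closed Q.r_inv Q.l_one)
      qed
      then show "act h ` ?Q = ?Q" using act_closed h by blast
    qed
    have "F (g \<otimes> h) = finprod ?M (\<lambda>U. ?c (m h U) \<otimes>\<^bsub>?M\<^esub> m g (act h U)) ?Q"
      unfolding F_def using g h m_N act_closed c_N cocycle
      by (intro M.finprod_cong') auto
    also have "\<dots> = finprod ?M (\<lambda>U. ?c (m h U)) ?Q \<otimes> finprod ?M (\<lambda>U. m g (act h U)) ?Q"
      using g h m_N act_closed c_N by (subst M.finprod_multf) auto
    also have "finprod ?M (\<lambda>U. ?c (m h U)) ?Q = ?c (F h)"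
      unfolding F_def using c_hom g h m_N by (subst M.hom_finprod) auto
    also have "finprod ?M (\<lambda>U. m g (act h U)) ?Q = F g"
      unfolding F_def using M.finprod_reindex[of "m g" "act h" ?Q] bij g m_N by auto
    finally show ?thesis .
  qed
  have F_pow: "F g = g [^] order (G Mod N)" if g: "g \<in> N" for g
  proof -
    have gG: "g \<in> carrier G" using g N.subset by blast
    have "m g U = g" if U: "U \<in> ?Q" for U
    proof -
      have "N #> g = \<one>\<^bsub>G Mod N\<^esub>" using g coset_join2 N.subgroup_axioms gG by simp
      then have "act g U = U" unfolding act_def using U by (simp only: Q.l_one)
      then show ?thesis unfolding m_def using gG s[OF U] by (simp add: m_assoc)
    qed
    then have "F g = finprod ?M (\<lambda>U. g) ?Q"
      unfolding F_def using g by (intro M.finprod_cong') auto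
    also have "\<dots> = g [^] order (G Mod N)"
      using M.finprod_const[of g ?Q] g by (simp add: order_def flip: nat_pow_consistent)
    finally show ?thesis .
  qed
  show thesis using that F_N F_mult F_pow by blast
qed

text \<open>
  When \<open>N\<close> has exponent dividing \<open>e\<close> and index \<open>n\<close> prime to \<open>e\<close>, the map \<open>g \<mapsto> (F g)\<^sup>j g\<close> built
  from the transfer \<open>F\<close> is an endomorphism whose restriction to \<open>N\<close> is the power map with
  exponent \<open>j n + 1\<close>, and \<open>j\<close> can be chosen so that this is \<open>a\<close> modulo \<open>e\<close>. Its kernel lies in
  \<open>N\<close>, where the power map is injective.
\<close>

lemma (in group) power_automorphism:
  fixes a e :: nat
  assumes fin: "finite (carrier G)"
    and N: "N \<lhd> G" and comm: "\<And>x y. x \<in> N \<Longrightarrow> y \<in> N \<Longrightarrow> x \<otimes> y = y \<otimes> x"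
    and exponent: "\<And>x. x \<in> N \<Longrightarrow> x [^] e = \<one>"
    and coprime: "coprime (order (G Mod N)) e" "coprime a e" and a: "a > 0"
  shows "\<exists>\<phi>\<in>auto G. \<forall>x\<in>N. \<phi> x = x [^] a"
proof -
  interpret N: normal N G by (rule N)
  let ?n = "order (G Mod N)"
  obtain F where F_N: "\<And>g. g \<in> carrier G \<Longrightarrow> F g \<in> N"
    and F_mult: "\<And>g h. g \<in> carrier G \<Longrightarrow> h \<in> carrier G \<Longrightarrow> F (g \<otimes> h) = g \<otimes> F h \<otimes> inv g \<otimes> F g"
    and F_pow: "\<And>g. g \<in> N \<Longrightarrow> F g = g [^] ?n"
    using transfer_crossed_hom[OF N comm] by blast
  obtain n' where n': "[?n * n' = 1] (mod e)"
    using cong_solve_coprime_nat coprime(1) by auto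
  define j where "j = n' * (a - 1)"
  have j: "[?n * j + 1 = a] (mod e)"
  proof -
    have "[?n * n' * (a - 1) + 1 = 1 * (a - 1) + 1] (mod e)"
      using n' by (intro cong_add cong_mult cong_refl)
    then show ?thesis using a by (simp add: j_def mult.assoc)
  qed
  have NG: "x \<in> carrier G" if "x \<in> N" for x using that N.subset by blast
  have pow_N: "x [^] (k::nat) \<in> N" if "x \<in> N" for x k
    using monoid.nat_pow_closed[OF group.is_monoid[OF subgroup_imp_group[OF N.subgroup_axioms]], of x k] that
    by (simp flip: nat_pow_consistent)
  define f where "f = (\<lambda>g. F g [^] j \<otimes> g)"
  have f_closed: "f g \<in> carrier G" if "g \<in> carrier G" for g
    using that F_N NG by (simp add: f_def)
  have f_N: "f x = x [^] a" if "x \<in> N" for x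
  proof -
    have "f x = x [^] (?n * j + 1)"
      using that NG[OF that] by (simp add: f_def F_pow nat_pow_pow)
    then show ?thesis
      using pow_cong_exponent[OF NG[OF that] exponent[OF that] j] by simp
  qed
  have f_mult: "f (g \<otimes> h) = f g \<otimes> f h" if g: "g \<in> carrier G" and h: "h \<in> carrier G" for g h
  proof -
    have Fg: "F g \<in> N" "F g \<in> carrier G" and Fh: "F h \<in> N" "F h \<in> carrier G"
      using F_N NG g h by auto
    have conj_N: "g \<otimes> x \<otimes> inv g \<in> N" if "x \<in> N" for x
      using that g N.inv_op_closed2 by blast
    have cancel: "inv g \<otimes> (g \<otimes> b) = b" if "b \<in> carrier G" for b
      using that g by (simp add: m_assoc[symmetric])
    have conj_pow: "(g \<otimes> x \<otimes> inv g) [^] (k::nat) = g \<otimes> x [^] k \<otimes> inv g" if "x \<in> carrier G" for x k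
      using that g by (induction k) (simp_all add: m_assoc cancel)
    have "f (g \<otimes> h) = (g \<otimes> F h [^] j \<otimes> inv g) \<otimes> F g [^] j \<otimes> (g \<otimes> h)"
    proof -
      have "F (g \<otimes> h) [^] j = (g \<otimes> F h \<otimes> inv g) [^] j \<otimes> F g [^] j"
        unfolding F_mult[OF g h]
        using g Fg Fh conj_N by (intro pow_mult_distrib comm) auto
      then show ?thesis
        unfolding f_def using Fh by (simp add: conj_pow)
    qed
    also have "(g \<otimes> F h [^] j \<otimes> inv g) \<otimes> F g [^] j = F g [^] j \<otimes> (g \<otimes> F h [^] j \<otimes> inv g)"
      using comm conj_N pow_N Fg Fh by simp
    finally show ?thesis
      unfolding f_def using g h Fg Fh by (simp add: m_assoc cancel)
  qed
  interpret f: group_hom G G f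
    using f_closed f_mult by unfold_locales (auto simp: hom_def)
  have "inj_on f (carrier G)"
  proof (rule f.inj_on_one_iff[THEN iffD2], intro allI impI)
    fix g assume g: "g \<in> carrier G" and "f g = \<one>"
    have Fg: "F g [^] j \<in> N" using F_N[OF g] pow_N by blast
    have "inv g = F g [^] j"
      using \<open>f g = \<one>\<close> g NG[OF Fg] by (intro inv_equality) (simp_all add: f_def)
    then have "inv (F g [^] j) = g" using g by (metis inv_inv)
    then have gN: "g \<in> N" using N.m_inv_closed[OF Fg] by simp
    then have "g [^] a = \<one>" using f_N \<open>f g = \<one>\<close> by simp
    then show "g = \<one>"
      using root_in_subgroup[OF g exponent[OF gN] triv_subgroup coprime(2)] by simp
  qed
  then have "bij_betw f (carrier G) (carrier G)"
    using endo_inj_surj[OF fin, of f] f_closed by (simp add: bij_betw_def image_subset_iff)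
  then have "restrict f (carrier G) \<in> auto G"
    using f_closed f_mult by (simp add: auto_def Bij_def hom_def)
  moreover have "restrict f (carrier G) x = x [^] a" if "x \<in> N" for x
    using f_N that NG by simp
  ultimately show ?thesis by blast
qed

section \<open>Orbits of elements of prime power order\<close>

text \<open>
  If the \<open>q\<close>-element \<open>y\<close> does not centralise \<open>x\<close>, then conjugation by the first \<open>q\<close> powers of
  \<open>y\<close> takes \<open>x\<close> to \<open>q\<close> different elements.
\<close>

lemma (in group) commute_if_small_orbit:
  fixes q b :: nat
  assumes fin: "finite (carrier G)" and q: "Factorial_Ring.prime q"
    and x: "x \<in> carrier G" and y: "y \<in> carrier G" "y [^] (q ^ b) = \<one>"
    and small: "card (aut_orbit G x) < q"
  shows "x \<otimes> y = y \<otimes> x"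
proof (rule ccontr)
  assume nc: "x \<otimes> y \<noteq> y \<otimes> x"
  let ?c = "\<lambda>g. g \<otimes> x \<otimes> inv g"
  interpret conj: group_action G "carrier G" "\<lambda>g. \<lambda>h\<in>carrier G. g \<otimes> h \<otimes> inv g"
    by (rule action_by_conjugation)
  define C where "C = stabilizer G (\<lambda>g. \<lambda>h\<in>carrier G. g \<otimes> h \<otimes> inv g) x"
  have C: "subgroup C G" unfolding C_def using x by (rule conj.stabilizer_subgroup)
  have C_iff: "g \<in> C \<longleftrightarrow> g \<otimes> x = x \<otimes> g" if "g \<in> carrier G" for g
    using that x by (auto simp: C_def stabilizer_def inv_solve_right' )
  have "y \<notin> C" using nc y C_iff by auto
  have "inj_on (\<lambda>i. ?c (y [^] i)) {..<q}"
  proof (rule inj_onI)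
    fix i j assume ij: "i \<in> {..<q}" "j \<in> {..<q}" and eq: "?c (y [^] i) = ?c (y [^] j)"
    define u v where "u = y [^] i" and "v = y [^] j"
    have uv: "u \<in> carrier G" "v \<in> carrier G" using y by (simp_all add: u_def v_def)
    have "u \<otimes> x \<otimes> inv u \<otimes> v = v \<otimes> x"
      using eq uv x unfolding u_def[symmetric] v_def[symmetric] by (simp add: m_assoc)
    then have "x \<otimes> (inv u \<otimes> v) = inv u \<otimes> v \<otimes> x"
      using uv x by (metis inv_closed inv_solve_left m_assoc m_closed)
    then have "inv u \<otimes> v \<in> C"
      using C_iff[of "inv u \<otimes> v"] uv by simp
    then show "i = j"
      using powers_in_distinct_cosets[OF q y C \<open>y \<notin> C\<close>] ij by (simp add: u_def v_def)
  qed
  moreover have "(\<lambda>i. ?c (y [^] i)) ` {..<q} \<subseteq> aut_orbit G x"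
  proof
    fix z assume "z \<in> (\<lambda>i. ?c (y [^] i)) ` {..<q}"
    then obtain i :: nat where z: "z = ?c (y [^] i)" by blast
    show "z \<in> aut_orbit G x"
      unfolding aut_orbit_eq_image z using conjugation_in_auto[of "y [^] i"] x y
      by (intro image_eqI) auto
  qed
  ultimately have "q \<le> card (aut_orbit G x)"
    using card_inj_on_le[OF _ _ finite_aut_orbit[OF fin]] by fastforce
  with small show False by simp
qed

text \<open>
  If all orbits of \<open>q\<close>-elements have fewer than \<open>q\<close> points, then the \<open>q\<close>-elements commute and
  form a normal abelian Sylow subgroup, whose index is prime to \<open>q\<close>. The power automorphisms of
  this subgroup spread a nontrivial element \<open>x\<close> over \<open>x, x\<^sup>2, \<dots>, x\<^sup>q\<^sup>-\<^sup>1\<close>.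
\<close>

lemma (in group) prime_power_element_with_large_orbit:
  fixes q :: nat
  assumes fin: "finite (carrier G)" and q: "Factorial_Ring.prime q" "q dvd order G"
    and small: "\<And>x b. x \<in> carrier G \<Longrightarrow> x [^] (q ^ (b::nat)) = \<one> \<Longrightarrow> card (aut_orbit G x) < q"
  obtains x b where "x \<in> carrier G" "x [^] (q ^ (b::nat)) = \<one>" "q - 1 \<le> card (aut_orbit G x)"
proof -
  have ord0: "order G \<noteq> 0" using fin order_gt_0_iff_finite by simp
  obtain b m where bm: "order G = q ^ b * m" "\<not> q dvd m"
    using ord0 q(1) by (metis multiplicity_decompose' not_prime_unit)
  \<comment> \<open>As \<open>q ^ b\<close> is the full power of \<open>q\<close> in the group order, \<open>N\<close> is the set of all
      \<open>q\<close>-elements.\<close>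
  define N where "N = {x \<in> carrier G. x [^] (q ^ b) = \<one>}"
  have N_comm: "x \<otimes> y = y \<otimes> x" if "x \<in> N" "y \<in> N" for x y
    using that commute_if_small_orbit[OF fin q(1)] small by (auto simp: N_def)
  have N_sub: "subgroup N G"
  proof (rule subgroupI)
    show "x \<otimes> y \<in> N" if "x \<in> N" "y \<in> N" for x y
      using that N_comm[OF that] by (auto simp: N_def pow_mult_distrib)
  qed (auto simp: N_def nat_pow_inv)
  have N: "N \<lhd> G"
    unfolding normal_inv_iff
  proof (intro conjI ballI N_sub)
    fix g x assume g: "g \<in> carrier G" and "x \<in> N"
    then have x: "x \<in> carrier G" "x [^] (q ^ b) = \<one>" by (auto simp: N_def)
    have cancel: "inv g \<otimes> (g \<otimes> b) = b" if "b \<in> carrier G" for b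
      using that g by (simp add: m_assoc[symmetric])
    have "(g \<otimes> x \<otimes> inv g) [^] (k::nat) = g \<otimes> x [^] k \<otimes> inv g" for k
      using x g by (induction k) (simp_all add: m_assoc cancel)
    then show "g \<otimes> x \<otimes> inv g \<in> N" using x g by (simp add: N_def)
  qed
  obtain S where S: "subgroup S G" "card S = q ^ b"
    using sylow_thm[OF q(1) is_group bm(1) fin] by blast
  have S_N: "S \<subseteq> N"
  proof
    fix x assume "x \<in> S"
    have "x [^]\<^bsub>G\<lparr>carrier := S\<rparr>\<^esub> order (G\<lparr>carrier := S\<rparr>) = \<one>\<^bsub>G\<lparr>carrier := S\<rparr>\<^esub>"
      using group.pow_order_eq_1[OF subgroup_imp_group[OF S(1)]] \<open>x \<in> S\<close> by simp
    then show "x \<in> N"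
      using \<open>x \<in> S\<close> S subgroup.subset[OF S(1)]
      by (auto simp: N_def order_def simp flip: nat_pow_consistent)
  qed
  \<comment> \<open>The index of \<open>N\<close> is prime to \<open>q\<close>, because \<open>N\<close> contains a Sylow subgroup.\<close>
  have "card S dvd card N"
  proof -
    have "subgroup S (G\<lparr>carrier := N\<rparr>)"
      using S_N S(1) N_sub subgroup_incl by blast
    then show ?thesis
      using group.lagrange[OF subgroup_imp_group[OF N_sub], of S]
      unfolding order_def by (simp, metis dvd_triv_right)
  qed
  then obtain k where k: "card N = q ^ b * k" using S(2) by (auto simp: dvd_def)
  have "order (G Mod N) * card N = order G"
    using lagrange[OF N_sub] by (simp add: order_def FactGroup_def)
  then have "q ^ b * (order (G Mod N) * k) = q ^ b * m"
    using bm(1) k by (simp add: mult_ac)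
  then have "order (G Mod N) * k = m" using q(1) by auto
  then have "\<not> q dvd order (G Mod N)" using bm(2) dvd_mult2 by blast
  then have "coprime q (order (G Mod N))" using q(1) prime_imp_coprime by blast
  then have coprime: "coprime (order (G Mod N)) (q ^ b)" by (simp add: coprime_commute)
  have "b > 0" using q bm by (metis gr0I mult_1 power_0)
  \<comment> \<open>A nontrivial element of \<open>N\<close> has the required orbit.\<close>
  then have "card S > 1" using S(2) q(1) by (metis one_less_power prime_gt_1_nat)
  then have "\<not> S \<subseteq> {\<one>}"
    using card_mono[of "{\<one>}" S] by auto
  then obtain x where x: "x \<in> S" "x \<noteq> \<one>" by blast
  then have xN: "x \<in> N" "x \<in> carrier G" "x [^] (q ^ b) = \<one>" using S_N by (auto simp: N_def)
  have "inj_on (\<lambda>i. x [^] i) {1..<q}"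
  proof (rule inj_onI)
    fix i j assume ij: "i \<in> {1..<q}" "j \<in> {1..<q}" and eq: "x [^] i = x [^] j"
    then show "i = j"
      using powers_in_distinct_cosets[OF q(1) xN(2,3) triv_subgroup, of i j] x(2) xN(2) by simp
  qed
  moreover have "(\<lambda>i. x [^] i) ` {1..<q} \<subseteq> aut_orbit G x"
  proof
    fix z assume "z \<in> (\<lambda>i. x [^] i) ` {1..<q}"
    then obtain i :: nat where "i \<in> {1..<q}" and z: "z = x [^] i" by blast
    then have i: "0 < i" "i < q" by auto
    have i_coprime: "coprime i (q ^ b)"
      using q(1) i(1,2) by (rule coprime_prime_power)
    have N_exponent: "y [^] (q ^ b) = \<one>" if "y \<in> N" for y
      using that by (simp add: N_def)
    obtain \<phi> where "\<phi> \<in> auto G" "\<forall>x\<in>N. \<phi> x = x [^] i"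
      using power_automorphism[OF fin N N_comm N_exponent coprime i_coprime i(1)] by blast
    then show "z \<in> aut_orbit G x"
      unfolding aut_orbit_eq_image z using xN(1) by (metis image_eqI)
  qed
  ultimately have "card {1..<q} \<le> card (aut_orbit G x)"
    using card_inj_on_le[OF _ _ finite_aut_orbit[OF fin]] by blast
  then show thesis using that xN by simp
qed

section \<open>Divisibility and the quotient\<close>

lemma denominator_le_if_fraction_le:
  fixes c u v :: real
  assumes "c / u \<le> c / v" "0 < c" "0 < u" "0 < v"
  shows "v \<le> u"
proof (rule ccontr)
  assume "\<not> v \<le> u"
  then have "c / v < c / u" using assms by (intro divide_strict_left_mono) auto
  with assms show False by simp
qed

text \<open>
  The divisibility is symmetric in \<open>p\<close> and \<open>q\<close>, so it is enough to treat \<open>p < q\<close> and \<open>p = q\<close>.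
  The difficulty is the case where \<open>p\<close> divides \<open>q - 1\<close>: then \<open>(p + q - 1) / (p q)\<close> is not in
  lowest terms and says nothing about \<open>p\<close>. The orbit of a \<open>q\<close>-element supplies the factor \<open>p\<close>.
\<close>

lemma (in group) aut_comm_prob_imp_dvd_less:
  fixes p q :: nat
  assumes fin: "finite (carrier G)" and p: "Factorial_Ring.prime p" and q: "Factorial_Ring.prime q"
    and prob: "aut_comm_prob G = (real p + real q - 1) / (real p * real q)"
    and less: "p < q"
  shows "p * q dvd order G * order (AutoGroup G)"
proof -
  let ?k = "card (orbits (AutoGroup G) (carrier G) (\<lambda>\<alpha>. \<alpha>))"
  have p2: "2 \<le> p" and q2: "2 \<le> q" using p q prime_ge_2_nat by auto
  have pos: "real (order G) > 0" using fin order_gt_0_iff_finite by simp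
  have "real ?k * (real p * real q) = (real p + real q - 1) * real (order G)"
    using aut_comm_prob_orbits[OF fin] prob pos p2 q2 by (simp add: field_simps)
  also have "real p + real q - 1 = real (p + q - 1)" using p2 by simp
  finally have count: "?k * (p * q) = (p + q - 1) * order G"
    by (metis of_nat_eq_iff of_nat_mult)
  \<comment> \<open>The prime \<open>q\<close> does not cancel in \<open>(p + q - 1) / (p q)\<close>, because \<open>0 < p - 1 < q\<close>.\<close>
  have "\<not> q dvd p + q - 1"
  proof
    assume "q dvd p + q - 1"
    then have "q dvd (p - 1) + q" using p2 by simp
    then have "q dvd p - 1" by simp
    then show False using p2 less by (simp add: nat_dvd_not_less)
  qed
  moreover have "q dvd (p + q - 1) * order G" by (metis count dvd_triv_right dvd_mult)
  ultimately have qG: "q dvd order G" using q prime_dvd_mult_iff by blast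
  have coprime: "coprime p q" using p q less primes_coprime by blast
  show ?thesis
  proof (cases "p dvd q - 1")
    case False
    have "\<not> p dvd p + q - 1"
    proof
      assume "p dvd p + q - 1"
      then have "p dvd p + (q - 1)" using q2 by simp
      then show False using False by simp
    qed
    moreover have "p dvd (p + q - 1) * order G" by (metis count dvd_triv_left dvd_mult)
    ultimately have "p dvd order G" using p prime_dvd_mult_iff by blast
    then have "p * q dvd order G" using qG coprime divides_mult by blast
    then show ?thesis by simp
  next
    case True
    \<comment> \<open>The value of the probability is the bound for orbits of size \<open>p\<close>, and the bound decreases
        when the orbit grows.\<close>
    have le_p: "card (aut_orbit G x) \<le> p"
      if x: "x \<in> carrier G" "x [^] (q ^ (b::nat)) = \<one>" for x b
    proof -
      let ?o = "real (card (aut_orbit G x))"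
      have o: "?o > 0" using card_aut_orbit_pos[OF fin] by simp
      have "(real p + real q - 1) / (real p * real q) \<le> 1 / q + (1 - 1 / q) / ?o"
        using aut_comm_prob_le_orbit[OF fin q x] prob by simp
      moreover have "(real p + real q - 1) / (real p * real q) = 1 / q + (1 - 1 / q) / p"
        using p2 q2 by (simp add: field_simps)
      ultimately have "(1 - 1 / q) / p \<le> (1 - 1 / q) / ?o" by simp
      moreover have "1 - 1 / real q > 0" using q2 by simp
      ultimately show ?thesis
        using denominator_le_if_fraction_le[of "1 - 1 / real q" "real p" ?o] o p2 by simp
    qed
    have lt_q: "card (aut_orbit G x) < q"
      if "x \<in> carrier G" "x [^] (q ^ (b::nat)) = \<one>" for x b
      using le_p[OF that] less by simp
    obtain x b where x: "x \<in> carrier G" "x [^] (q ^ (b::nat)) = \<one>" "q - 1 \<le> card (aut_orbit G x)"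
      by (rule prime_power_element_with_large_orbit[OF fin q qG lt_q])
    \<comment> \<open>The two bounds on this orbit force \<open>p = q - 1\<close>.\<close>
    have "p \<le> q - 1" using True q2 by (simp add: dvd_imp_le)
    then have "card (aut_orbit G x) = p" using le_p[OF x(1,2)] x(3) by simp
    then have "p dvd order (AutoGroup G)"
      using aut_orbit_stabilizer[OF x(1)] by (metis dvd_triv_left)
    then show ?thesis using qG by (metis mult.commute mult_dvd_mono)
  qed
qed

lemma (in group) aut_comm_prob_imp_dvd:
  fixes p q :: nat
  assumes fin: "finite (carrier G)" and p: "Factorial_Ring.prime p" and q: "Factorial_Ring.prime q"
    and prob: "aut_comm_prob G = (real p + real q - 1) / (real p * real q)"
  shows "p * q dvd order G * order (AutoGroup G)"
proof (cases p q rule: linorder_cases)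
  case less
  then show ?thesis using aut_comm_prob_imp_dvd_less[OF fin p q prob] by simp
next
  case greater
  have "aut_comm_prob G = (real q + real p - 1) / (real q * real p)"
    using prob by (simp add: algebra_simps)
  then show ?thesis
    using aut_comm_prob_imp_dvd_less[OF fin q p _ greater] by (simp add: mult.commute)
next
  case equal
  let ?k = "card (orbits (AutoGroup G) (carrier G) (\<lambda>\<alpha>. \<alpha>))"
  have p2: "2 \<le> p" using p prime_ge_2_nat by auto
  have pos: "real (order G) > 0" using fin order_gt_0_iff_finite by simp
  have "real ?k * (real p * real p) = (real p + real p - 1) * real (order G)"
    using aut_comm_prob_orbits[OF fin] prob pos p2 equal by (simp add: field_simps)
  also have "real p + real p - 1 = real (p + p - 1)" using p2 by simp
  finally have count: "?k * (p * p) = (p + p - 1) * order G"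
    by (metis of_nat_eq_iff of_nat_mult)
  have "coprime p (p + p - 1)"
  proof -
    have "\<not> p dvd p - 1" using p2 by (simp add: nat_dvd_not_less)
    then have "\<not> p dvd p + (p - 1)" using dvd_add_triv_left_iff by blast
    then show ?thesis using p p2 prime_imp_coprime by simp
  qed
  then have "coprime (p * p) (p + p - 1)" by simp
  moreover have "p * p dvd (p + p - 1) * order G" by (metis count dvd_triv_right)
  ultimately have "p * p dvd order G" using coprime_dvd_mult_right_iff by blast
  then show ?thesis using equal by simp
qed

text \<open>A group of prime order is generated by any \<open>x \<noteq> \<one>\<close>, and \<open>k \<mapsto> x\<^sup>k\<close> is the isomorphism.\<close>

lemma (in group) prime_order_iso_integer_mod_group:
  assumes "Factorial_Ring.prime (order G)"
  shows "G \<cong> integer_mod_group (order G)"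
proof -
  let ?n = "order G" and ?Z = "integer_mod_group (order G)"
  have n: "?n > 1" using assms prime_gt_1_nat by blast
  then have "\<not> carrier G \<subseteq> {\<one>}"
    unfolding order_def using card_mono[of "{\<one>}" "carrier G"] by auto
  then obtain x where x: "x \<in> carrier G" "x \<noteq> \<one>" by blast
  have "ord x \<noteq> 1" using x ord_eq_1 by simp
  then have ord: "ord x = ?n"
    using ord_dvd_group_order[OF x(1)] assms by (auto simp: prime_nat_iff)
  have Z: "carrier ?Z = {0..<int ?n}" using n by (simp add: carrier_integer_mod_group)
  have "(\<lambda>k::int. x [^] k) \<in> hom ?Z G"
  proof (rule homI)
    fix k l :: int
    have "x [^] ((k + l) mod int ?n) = x [^] (k + l)"
      using int_pow_eq[OF x(1)] ord by (metis mod_eq_dvd_iff mod_mod_trivial)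
    then show "x [^] (k \<otimes>\<^bsub>?Z\<^esub> l) = x [^] k \<otimes> x [^] l"
      using x by (simp add: int_pow_mult)
  qed (use x in auto)
  moreover have inj: "inj_on (\<lambda>k::int. x [^] k) (carrier ?Z)"
  proof (rule inj_onI)
    fix k l assume kl: "k \<in> carrier ?Z" "l \<in> carrier ?Z" and "x [^] k = x [^] l"
    then have "k mod int ?n = l mod int ?n"
      using int_pow_eq[OF x(1)] ord by (metis mod_eq_dvd_iff)
    then show "k = l" using kl Z by simp
  qed
  moreover have "(\<lambda>k::int. x [^] k) ` carrier ?Z = carrier G"
  proof (rule card_subset_eq)
    show "finite (carrier G)" using n by (metis card.infinite not_less_zero order_def)
    show "(\<lambda>k::int. x [^] k) ` carrier ?Z \<subseteq> carrier G" using x by auto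
    show "card ((\<lambda>k::int. x [^] k) ` carrier ?Z) = card (carrier G)"
      using card_image[OF inj] unfolding Z by (simp add: order_def)
  qed
  ultimately have "(\<lambda>k::int. x [^] k) \<in> iso ?Z G"
    by (simp add: iso_def bij_betw_def)
  then have "?Z \<cong> G" by (auto simp: is_iso_def)
  then show ?thesis by (rule group.iso_sym[OF group_integer_mod_group])
qed

lemma (in group) aut_comm_prob_imp_quotient:
  fixes p q :: nat
  assumes fin: "finite (carrier G)"
    and p: "smallest_prime_divisor p (order (AutoGroup G))"
    and q: "smallest_prime_divisor q (order G)"
    and prob: "aut_comm_prob G = (real p + real q - 1) / (real p * real q)"
  shows "G Mod aut_fixed G \<cong> integer_mod_group q"
proof -
  let ?i = "order (G Mod aut_fixed G)"
  have p2: "2 \<le> p" and q2: "2 \<le> q"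
    using p q prime_ge_2_nat by (auto simp: smallest_prime_divisor_def)
  have index: "?i * card (aut_fixed G) = order G"
    using lagrange[OF normal_imp_subgroup[OF aut_fixed_normal]]
    by (simp add: order_def FactGroup_def)
  have i0: "?i > 0" using index fin order_gt_0_iff_finite by (metis gr0I mult_0)
  have "?i \<le> q"
  proof -
    have "(real p + real q - 1) / (real p * real q) = 1 / p + (1 - 1 / p) / q"
      using p2 q2 by (simp add: field_simps)
    then have "(1 - 1 / p) / q \<le> (1 - 1 / p) / real ?i"
      using aut_comm_prob_le_index[OF fin p] prob by simp
    moreover have "1 - 1 / real p > 0" using p2 by simp
    ultimately show ?thesis
      using denominator_le_if_fraction_le[of "1 - 1 / real p" "real q" "real ?i"] i0 q2 by simp
  qed
  \<comment> \<open>With index 1 the probability would be 1, but \<open>(p + q - 1) / (p q) = 1\<close> means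
      \<open>(p - 1) (q - 1) = 0\<close>.\<close>
  moreover have "?i \<noteq> 1"
  proof
    assume "?i = 1"
    then have "card (aut_fixed G) = card (carrier G)" using index by (simp add: order_def)
    then have L: "aut_fixed G = carrier G"
      using fin by (intro card_subset_eq) (auto simp: aut_fixed_def)
    then have "{(x, \<alpha>) \<in> carrier G \<times> auto G. \<alpha> x = x} = carrier G \<times> auto G"
      by (auto simp: aut_fixed_def carrier_AutoGroup)
    then have "aut_comm_prob G = 1"
      using fin order_gt_0_iff_finite order_AutoGroup_pos[OF fin]
      by (auto simp: aut_comm_prob_def carrier_AutoGroup card_cartesian_product order_def)
    then have "(real p - 1) * (real q - 1) = 0"
      using prob p2 q2 by (simp add: field_simps)
    then show False using p2 q2 by simp
  qed
  ultimately have "?i = q"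
  proof -
    obtain r where r: "Factorial_Ring.prime r" "r dvd ?i"
      using \<open>?i \<noteq> 1\<close> prime_factor_nat by blast
    then have "q \<le> r" using q index by (metis dvd_mult2 smallest_prime_divisor_def)
    also have "r \<le> ?i" using r i0 by (simp add: dvd_imp_le)
    finally show ?thesis using \<open>?i \<le> q\<close> by simp
  qed
  moreover have "group (G Mod aut_fixed G)"
    by (rule normal.factorgroup_is_group[OF aut_fixed_normal])
  ultimately show ?thesis
    using group.prime_order_iso_integer_mod_group q by (metis smallest_prime_divisor_def)
qed

theorem proposition4p1:
  fixes G :: "('a, 'b) monoid_scheme"
  assumes "group G" and "finite (carrier G)"
  shows "(\<forall>p q :: nat.
            Factorial_Ring.prime p \<and> Factorial_Ring.prime q \<and>
            aut_comm_prob G = (real p + real q - 1) / (real p * real q) \<longrightarrow>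
              p * q dvd order G * order (AutoGroup G) \<and>
              (smallest_prime_divisor p (order (AutoGroup G)) \<and>
               smallest_prime_divisor q (order G) \<longrightarrow>
                 G Mod aut_fixed G \<cong> integer_mod_group q)) \<and>
         (even (order G) \<and> even (order (AutoGroup G)) \<and> aut_comm_prob G = 3 / 4 \<longrightarrow>
            G Mod aut_fixed G \<cong> integer_mod_group 2)"
proof -
  interpret group G by (rule assms(1))
  have two: "smallest_prime_divisor 2 n" if "even n" for n
    using that prime_ge_2_nat by (auto simp: smallest_prime_divisor_def)
  show ?thesis
    using aut_comm_prob_imp_dvd[OF assms(2)] aut_comm_prob_imp_quotient[OF assms(2)]
      aut_comm_prob_imp_quotient[OF assms(2) two two] by auto
qed

end
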